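(* For all $0<\alpha\leq1$ and all $N_0>0$ there exists a finite set $Y\subseteq\mathbb{Z}$ with $|Y|\geq N_0$ and a set $L$ of lines in $\mathbb{R}^2$ in general position, each $\alpha$-rich in $Y\times Y$, such that \[ |L|\gg(1-\alpha)\frac{\log|Y|}{\log\log|Y|}. \]
   Context: A line $\ell$ is $\alpha$-rich in $Y\times Y$ if $|\ell\cap(Y\times Y)|\geq\alpha|Y|$. A set of lines is in general position if no two are parallel and no three pass through a common point. $f\gg g$ means $f\geq cg$ for an absolute constant $c>0$. *)

theory Defs
  imports "HOL-Analysis.Analysis"
begin

definition is_line :: "(real \<times> real) set \<Rightarrow> bool" where
  "is_line l \<longleftrightarrow> affine l \<and> aff_dim l = 1"

definition real_grid :: "int set \<Rightarrow> (real \<times> real) set" where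
  "real_grid Y = (real_of_int ` Y) \<times> (real_of_int ` Y)"

definition rich :: "real \<Rightarrow> int set \<Rightarrow> (real \<times> real) set \<Rightarrow> bool" where
  "rich \<alpha> Y l \<longleftrightarrow> real (card (l \<inter> real_grid Y)) \<ge> \<alpha> * real (card Y)"

(* affine_parallel is the translate relation; it is reflexive, so distinctness is required. *)
definition general_position :: "(real \<times> real) set set \<Rightarrow> bool" where
  "general_position L \<longleftrightarrow>
     (\<forall>l\<in>L. \<forall>m\<in>L. l \<noteq> m \<longrightarrow> \<not> affine_parallel l m) \<and>
     (\<forall>l\<in>L. \<forall>m\<in>L. \<forall>n\<in>L. l \<noteq> m \<and> l \<noteq> n \<and> m \<noteq> n \<longrightarrow> l \<inter> m \<inter> n = {})"

end

theory Submission
  imports Defs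
begin

text \<open>
  Let \<open>Y\<close> consist of the integers \<open>2^e (2n + 1)\<close> with \<open>e < E\<close> and \<open>n < N\<close>, and take the lines
  \<open>y = 2^i x + 4^i 2^(E+1)\<close> for \<open>1 \<le> i \<le> k\<close>. Multiplication by \<open>2^i\<close> shifts \<open>e\<close> by \<open>i\<close>, and because
  the intercept is divisible by \<open>2^(E+1)\<close>, adding it only shifts \<open>n\<close>, by at most \<open>4^k 2^E\<close>. Hence each
  line is \<open>(1 - 1/M)\<^sup>2\<close>-rich as soon as \<open>E = M k\<close> and \<open>N = M 4^k 2^E\<close>, while \<open>ln |Y| = O(M k)\<close>.
  The coefficient pairs of the lines lie on a parabola, which gives general position. With
  \<open>M\<close> of order \<open>1 / (1 - \<alpha>)\<close> this even yields \<open>|L| \<ge> c (1 - \<alpha>) ln |Y|\<close>.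
\<close>

section \<open>Non-vertical lines in the plane\<close>

definition graph_line :: "real \<Rightarrow> real \<Rightarrow> (real \<times> real) set" where
  "graph_line a b = {(x, y). y = a * x + b}"

lemma mem_graph_line [simp]: "(x, y) \<in> graph_line a b \<longleftrightarrow> y = a * x + b"
  by (simp add: graph_line_def)

text \<open>The points over 0 and 1 span the line; being distinct, they give affine dimension
  1.\<close>

lemma graph_line_eq_affine_hull: "graph_line a b = affine hull {(0, b), (1, a + b)}"
proof -
  have "graph_line a b = {u *\<^sub>R (0, b) + v *\<^sub>R (1, a + b) | u v. u + v = 1}"
  proof (intro set_eqI iffI)
    fix p assume "p \<in> graph_line a b"
    then obtain x where "p = (x, a * x + b)"
      by (cases p) auto
    then have "p = (1 - x) *\<^sub>R (0, b) + x *\<^sub>R (1, a + b)"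
      by (simp add: algebra_simps)
    moreover have "(1 - x) + x = 1"
      by simp
    ultimately show "p \<in> {u *\<^sub>R (0, b) + v *\<^sub>R (1, a + b) | u v. u + v = 1}"
      by blast
  next
    fix p :: "real \<times> real" assume "p \<in> {u *\<^sub>R (0, b) + v *\<^sub>R (1, a + b) | u v. u + v = 1}"
    then obtain u v where "p = (v, u * b + v * (a + b))" "u = 1 - v"
      by (auto simp: eq_diff_eq)
    then show "p \<in> graph_line a b"
      by (simp add: algebra_simps)
  qed
  then show ?thesis
    by (simp add: affine_hull_2)
qed

lemma is_line_graph_line: "is_line (graph_line a b)"
  by (simp add: is_line_def graph_line_eq_affine_hull aff_dim_affine_hull aff_dim_2)

text \<open>A translation moves the points over 0 and 1 to two points of the second line whose
  coordinates still differ by 1 and \<open>a\<close>.\<close>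

lemma affine_parallel_graph_line_imp_slope_eq:
  assumes "affine_parallel (graph_line a b) (graph_line a' b')"
  shows "a = a'"
proof -
  obtain u v where uv: "graph_line a' b' = (\<lambda>p. (u, v) + p) ` graph_line a b"
    using assms unfolding affine_parallel_def by (metis surj_pair)
  have "(u, v + b) \<in> graph_line a' b'"
    unfolding uv by (rule image_eqI [of _ _ "(0, b)"]) simp_all
  moreover have "(u + 1, v + a + b) \<in> graph_line a' b'"
    unfolding uv by (rule image_eqI [of _ _ "(1, a + b)"]) simp_all
  ultimately show ?thesis
    unfolding mem_graph_line distrib_left by linarith
qed

lemma graph_line_slope_inject: "graph_line a b = graph_line a' b' \<Longrightarrow> a = a'"
  using affine_parallel_graph_line_imp_slope_eq affine_parallel_reflex by metis

text \<open>If the lines of distinct slopes \<open>r\<close> and \<open>s\<close> meet over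
  \<open>x\<close>, subtracting their equations and cancelling \<open>r - s\<close> gives
  \<open>x = - c * (r + s)\<close>. A third line of slope \<open>t\<close> through that point would
  give \<open>x = - c * (r + t)\<close>, forcing \<open>s = t\<close>.\<close>

lemma general_position_parabola:
  fixes c :: real
  assumes "c \<noteq> 0"
  shows "general_position ((\<lambda>t. graph_line t (c * t\<^sup>2)) ` T)"
proof -
  have *: False
    if eqs: "y = r * x + c * r\<^sup>2" "y = s * x + c * s\<^sup>2" "y = t * x + c * t\<^sup>2"
      and neqs: "r \<noteq> s" "r \<noteq> t" "s \<noteq> t" for r s t x y
  proof -
    have "(r - s) * (x + c * (r + s)) = 0" "(r - t) * (x + c * (r + t)) = 0"
      using eqs by (simp_all add: algebra_simps power2_eq_square)
    then have "x + c * (r + s) = x + c * (r + t)"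
      using neqs by simp
    then show False
      using assms neqs by simp
  qed
  show ?thesis
    unfolding general_position_def
  proof (intro conjI ballI impI)
    fix l m
    assume "l \<in> (\<lambda>t. graph_line t (c * t\<^sup>2)) ` T" "m \<in> (\<lambda>t. graph_line t (c * t\<^sup>2)) ` T" "l \<noteq> m"
    then show "\<not> affine_parallel l m"
      using affine_parallel_graph_line_imp_slope_eq by blast
  next
    fix l m n
    assume "l \<in> (\<lambda>t. graph_line t (c * t\<^sup>2)) ` T" "m \<in> (\<lambda>t. graph_line t (c * t\<^sup>2)) ` T"
      "n \<in> (\<lambda>t. graph_line t (c * t\<^sup>2)) ` T" "l \<noteq> m \<and> l \<noteq> n \<and> m \<noteq> n"
    then obtain r s t where "l = graph_line r (c * r\<^sup>2)" "m = graph_line s (c * s\<^sup>2)"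
      "n = graph_line t (c * t\<^sup>2)" "r \<noteq> s" "r \<noteq> t" "s \<noteq> t"
      by blast
    then show "l \<inter> m \<inter> n = {}"
      using * by (auto simp del: add_left_cancel add_right_cancel) blast
  qed
qed

section \<open>Integers indexed by 2-adic valuation and odd part\<close>

definition dyadic :: "nat \<times> nat \<Rightarrow> int" where
  "dyadic = (\<lambda>(e, n). 2 ^ e * (2 * int n + 1))"

text \<open>Induction on the exponent: parity decides whether the other exponent is 0, and otherwise
  a factor 2 cancels.\<close>

lemma inj_dyadic: "inj dyadic"
proof -
  have "e = e' \<and> n = n'" if "2 ^ e * (2 * int n + 1) = 2 ^ e' * (2 * int n' + 1)" for e n e' n'
    using that
  proof (induction e arbitrary: e')
    case 0
    then have "odd (2 ^ e' * (2 * int n' + 1))"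
      by (metis even_plus_one_iff dvd_triv_left mult_1 power_0)
    then have "e' = 0"
      by auto
    with 0 show ?case
      by simp
  next
    case (Suc e)
    then have "even (2 ^ e' * (2 * int n' + 1))"
      by (metis dvd_mult2 dvd_triv_left power_Suc)
    then obtain d where "e' = Suc d"
      by (cases e') auto
    with Suc show ?case
      by auto
  qed
  then show ?thesis
    by (auto simp: inj_def dyadic_def)
qed

definition dyadic_set :: "nat \<Rightarrow> nat \<Rightarrow> int set" where
  "dyadic_set E N = dyadic ` ({..<E} \<times> {..<N})"

lemma finite_dyadic_set: "finite (dyadic_set E N)"
  by (simp add: dyadic_set_def)

lemma card_dyadic_set: "card (dyadic_set E N) = E * N"
  by (simp add: dyadic_set_def card_image inj_on_subset [OF inj_dyadic] card_cartesian_product)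

text \<open>The power \<open>2 ^ (e + i)\<close> divides \<open>2 ^ E\<close> and can be factored
  out; the extra 2 in \<open>2 ^ Suc E\<close> keeps the remaining factor odd.\<close>

lemma dyadic_affine:
  assumes "e + i < E"
  shows "2 ^ i * dyadic (e, n) + int b * 2 ^ Suc E = dyadic (e + i, n + b * 2 ^ (E - (e + i)))"
proof -
  have "(2::int) ^ E = 2 ^ (e + i) * 2 ^ (E - (e + i))"
    using assms by (simp flip: power_add)
  then show ?thesis
    by (simp add: dyadic_def algebra_simps power_add)
qed

lemma card_graph_line_dyadic_ge:
  "(E - i) * (N - b * 2 ^ E) \<le>
    card (graph_line (2 ^ i) (real b * 2 ^ Suc E) \<inter> real_grid (dyadic_set E N))"
proof -
  define f where
    "f p = (real_of_int (dyadic p), real_of_int (2 ^ i * dyadic p + int b * 2 ^ Suc E))" for p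
  \<comment> \<open>These indices stay in range after both shifts, the shift of \<open>n\<close>
    being at most \<open>b * 2 ^ E\<close> for every \<open>e\<close>.\<close>
  let ?D = "{..<E - i} \<times> {..<N - b * 2 ^ E}"
  let ?I = "graph_line (2 ^ i) (real b * 2 ^ Suc E) \<inter> real_grid (dyadic_set E N)"
  have "f (e, n) \<in> ?I" if "e < E - i" "n < N - b * 2 ^ E" for e n
  proof -
    have "b * 2 ^ (E - (e + i)) \<le> b * 2 ^ E"
      by (intro mult_left_mono power_increasing) auto
    then have "n + b * 2 ^ (E - (e + i)) < N"
      using that by linarith
    moreover have "e + i < E" "e < E" "n < N"
      using that by auto
    ultimately have "dyadic (e, n) \<in> dyadic_set E N"
      "2 ^ i * dyadic (e, n) + int b * 2 ^ Suc E \<in> dyadic_set E N"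
      unfolding dyadic_set_def dyadic_affine [OF \<open>e + i < E\<close>] by blast+
    then have "f (e, n) \<in> real_grid (dyadic_set E N)"
      unfolding f_def real_grid_def by blast
    moreover have "f (e, n) \<in> graph_line (2 ^ i) (real b * 2 ^ Suc E)"
      by (simp add: f_def)
    ultimately show ?thesis
      by blast
  qed
  then have "f ` ?D \<subseteq> ?I"
    by auto
  moreover have "finite ?I"
    by (simp add: real_grid_def finite_dyadic_set)
  moreover have "inj_on f ?D"
    using inj_dyadic by (auto simp: inj_on_def f_def inj_def)
  ultimately have "card ?D \<le> card ?I"
    by (metis card_image card_mono)
  then show ?thesis
    by (simp add: card_cartesian_product)
qed

section \<open>Choice of parameters\<close>

lemma rich_dyadic:
  fixes M k i :: nat and \<alpha> :: real
  assumes "M > 0" "i \<le> k" "\<alpha> \<le> (1 - 1 / real M)\<^sup>2"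
  shows "rich \<alpha> (dyadic_set (M * k) (M * (4 ^ k * 2 ^ (M * k))))
    (graph_line (2 ^ i) (2 ^ Suc (M * k) * (2 ^ i)\<^sup>2))"
proof -
  \<comment> \<open>The exponent range has length \<open>M * k\<close> and loses at most
    \<open>k\<close>; the range of \<open>n\<close> has length \<open>M * B\<close> and loses at
    most \<open>B\<close>. Each keeps a proportion of at least \<open>1 - 1 / M\<close>.\<close>
  define E B where "E = M * k" and "B = (4 ^ k * 2 ^ E :: nat)"
  have "(4::nat) ^ i * 2 ^ E \<le> B"
    unfolding B_def using assms by (intro mult_right_mono power_increasing) auto
  then have "(M - 1) * B \<le> M * B - 4 ^ i * 2 ^ E"
    by (simp add: diff_mult_distrib)
  moreover have "(M - 1) * k \<le> E - i"
    using assms unfolding E_def by (simp add: diff_mult_distrib)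
  ultimately have "((M - 1) * k) * ((M - 1) * B) \<le> (E - i) * (M * B - 4 ^ i * 2 ^ E)"
    by (intro mult_mono) auto
  also have "\<dots> \<le> card (graph_line (2 ^ i) (real (4 ^ i) * 2 ^ Suc E) \<inter> real_grid (dyadic_set E (M * B)))"
    by (rule card_graph_line_dyadic_ge)
  \<comment> \<open>This puts the intercept in the form \<open>c * t\<^sup>2\<close> with slope
    \<open>t = 2 ^ i\<close>, as general position requires.\<close>
  also have "real (4 ^ i) * 2 ^ Suc E = 2 ^ Suc E * (2 ^ i)\<^sup>2"
    by (simp add: power2_eq_square flip: power_mult_distrib)
  finally have le: "real (((M - 1) * k) * ((M - 1) * B)) \<le>
      real (card (graph_line (2 ^ i) (2 ^ Suc E * (2 ^ i)\<^sup>2) \<inter> real_grid (dyadic_set E (M * B))))"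
    by (rule of_nat_mono)
  have "\<alpha> * real (E * (M * B)) \<le> (1 - 1 / real M)\<^sup>2 * real (E * (M * B))"
    using assms by (intro mult_right_mono) auto
  also have "\<dots> = real (((M - 1) * k) * ((M - 1) * B))"
    using assms by (simp add: E_def of_nat_diff power2_eq_square field_simps)
  also note le
  finally show ?thesis
    unfolding rich_def card_dyadic_set E_def B_def .
qed

text \<open>Bounding \<open>M\<close> by \<open>2 ^ M\<close> and \<open>k\<close> by
  \<open>2 ^ k\<close> turns the cardinality into one power of 2, and
  \<open>ln 2 < 1\<close>.\<close>

lemma ln_card_dyadic_set_le:
  assumes "M > 0" "k > 0"
  shows "ln (real (card (dyadic_set (M * k) (M * (4 ^ k * 2 ^ (M * k)))))) \<le> 6 * real M * real k"
proof -
  have "M * k * (M * (4 ^ k * 2 ^ (M * k))) \<le> 2 ^ M * 2 ^ k * (2 ^ M * (2 ^ (2 * k) * 2 ^ (M * k)))"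
    by (intro mult_mono) (auto simp: power_mult less_imp_le)
  also have "\<dots> = 2 ^ (2 * M + 3 * k + M * k)"
    by (simp flip: power_add)
  also have "\<dots> \<le> 2 ^ (6 * (M * k))"
  proof (rule power_increasing)
    have "M \<le> M * k" "k \<le> M * k"
      using assms by auto
    then show "2 * M + 3 * k + M * k \<le> 6 * (M * k)"
      by linarith
  qed simp
  finally have "real (M * k * (M * (4 ^ k * 2 ^ (M * k)))) \<le> 2 ^ (6 * (M * k))"
    by (metis of_nat_le_iff of_nat_numeral of_nat_power)
  then have "ln (real (M * k * (M * (4 ^ k * 2 ^ (M * k))))) \<le> ln (2 ^ (6 * (M * k)))"
    using assms by (intro ln_mono) auto
  also have "\<dots> = real (6 * (M * k)) * ln 2"
    by (rule ln_realpow)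
  also have "\<dots> \<le> real (6 * (M * k)) * 1"
    using ln_2_less_1 by (intro mult_left_mono) auto
  finally show ?thesis
    by (simp add: card_dyadic_set mult.assoc)
qed

theorem theorem2p4:
  "\<exists>c::real. c > 0 \<and>
     (\<forall>\<alpha>::real. \<forall>N0::real. 0 < \<alpha> \<and> \<alpha> \<le> 1 \<and> N0 > 0 \<longrightarrow>
       (\<exists>(Y::int set) (L::(real \<times> real) set set).
          finite Y \<and> real (card Y) \<ge> N0 \<and>
          finite L \<and> (\<forall>l\<in>L. is_line l) \<and> general_position L \<and>
          (\<forall>l\<in>L. rich \<alpha> Y l) \<and>
          real (card L) \<ge> c * (1 - \<alpha>) * (ln (real (card Y)) / ln (ln (real (card Y))))))"
proof (intro exI [of _ "1 / 18"] conjI allI impI)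
  fix \<alpha> N0 :: real
  assume asm: "0 < \<alpha> \<and> \<alpha> \<le> 1 \<and> N0 > 0"
  show "\<exists>(Y::int set) (L::(real \<times> real) set set).
          finite Y \<and> real (card Y) \<ge> N0 \<and>
          finite L \<and> (\<forall>l\<in>L. is_line l) \<and> general_position L \<and>
          (\<forall>l\<in>L. rich \<alpha> Y l) \<and>
          real (card L) \<ge> 1 / 18 * (1 - \<alpha>) * (ln (real (card Y)) / ln (ln (real (card Y))))"
  proof (cases "\<alpha> = 1")
    case True
    \<comment> \<open>The required number of lines is 0 here, so no lines and any large enough
      \<open>Y\<close> suffice.\<close>
    obtain n where "N0 \<le> real n"
      using real_arch_simple by blast
    then show ?thesis
      using True
      by (intro exI [of _ "dyadic_set 1 n"] exI [of _ "{}"])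
        (auto simp: finite_dyadic_set card_dyadic_set general_position_def)
  next
    case False
    then have \<alpha>: "0 < 1 - \<alpha>" "1 - \<alpha> < 1"
      using asm by auto
    \<comment> \<open>Rounding \<open>2 / (1 - \<alpha>)\<close> up gives
      \<open>(1 - 1 / M)\<^sup>2 \<ge> 1 - 2 / M \<ge> \<alpha>\<close>, while
      \<open>(1 - \<alpha>) * M\<close> stays at most 3.\<close>
    define M where "M = nat \<lceil>2 / (1 - \<alpha>)\<rceil>"
    have M: "2 / (1 - \<alpha>) \<le> real M" "real M \<le> 2 / (1 - \<alpha>) + 1"
      unfolding M_def using \<alpha> by (auto simp: less_imp_le of_nat_nat)
    have "M > 0"
      using M(1) \<alpha> by (cases M) (auto simp: field_simps)
    have M_le: "(1 - \<alpha>) * real M \<le> 3"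
      using M(2) \<alpha> by (simp add: field_simps)
    have "2 / real M \<le> 1 - \<alpha>"
      using M(1) \<alpha> \<open>M > 0\<close> by (simp add: field_simps)
    then have rich_le: "\<alpha> \<le> (1 - 1 / real M)\<^sup>2"
      by (simp add: power2_diff)
        (smt (verit) zero_le_power2)
    \<comment> \<open>Since \<open>k\<close> is at most \<open>card Y\<close>, the bound
      \<open>exp (exp 1)\<close> makes the iterated logarithm at least 1, so dividing by it cannot
      increase \<open>ln (card Y)\<close>.\<close>
    obtain k where k: "max N0 (exp (exp 1)) \<le> real k"
      using real_arch_simple by blast
    have "k > 0"
      using k asm by (cases k) auto
    define Y where "Y = dyadic_set (M * k) (M * (4 ^ k * 2 ^ (M * k)))"
    define L where "L = (\<lambda>t. graph_line t (2 ^ Suc (M * k) * t\<^sup>2)) ` ((\<lambda>i. 2 ^ i) ` {1..k})"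
    have "1 * k * (1 * (1 * 1)) \<le> M * k * (M * (4 ^ k * 2 ^ (M * k)))"
      using \<open>M > 0\<close> by (intro mult_mono) auto
    then have k_le: "real k \<le> real (card Y)"
      unfolding Y_def card_dyadic_set by (metis mult_1 mult_1_right of_nat_le_iff)
    have "exp (exp 1) \<le> real (card Y)"
      using k k_le by simp
    then have ln_ge: "exp 1 \<le> ln (real (card Y))"
      by (subst ln_ge_iff) (use k_le \<open>k > 0\<close> in auto)
    then have lnln_ge: "1 \<le> ln (ln (real (card Y)))"
      by (subst ln_ge_iff) (use ln_ge exp_gt_zero [of "1::real"] in linarith)+
    have "inj_on (\<lambda>i. 2 ^ i :: real) {1..k}"
      by (auto simp: inj_on_def)
    moreover have "inj (\<lambda>t. graph_line t (2 ^ Suc (M * k) * t\<^sup>2))"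
      by (auto intro!: injI dest: graph_line_slope_inject)
    ultimately have card_L: "card L = k"
      unfolding L_def by (simp add: card_image inj_on_subset)
    have "0 \<le> ln (real (card Y))"
      using ln_ge exp_gt_zero [of "1::real"] by linarith
    then have "ln (real (card Y)) / ln (ln (real (card Y))) \<le> ln (real (card Y)) / 1"
      using lnln_ge by (intro divide_left_mono) auto
    also have "\<dots> = ln (real (card Y))"
      by simp
    also have "\<dots> \<le> 6 * real M * real k"
      unfolding Y_def using \<open>M > 0\<close> \<open>k > 0\<close> by (rule ln_card_dyadic_set_le)
    \<comment> \<open>The 18 is the 6 of the logarithm bound times the 3 bounding
      \<open>(1 - \<alpha>) * M\<close>.\<close>
    finally have "1 / 18 * (1 - \<alpha>) * (ln (real (card Y)) / ln (ln (real (card Y))))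
        \<le> 1 / 18 * (1 - \<alpha>) * (6 * real M * real k)"
      using \<alpha> by (intro mult_left_mono) auto
    also have "\<dots> = (1 - \<alpha>) * real M * (real k / 3)"
      by simp
    also have "\<dots> \<le> 3 * (real k / 3)"
      using M_le by (rule mult_right_mono) simp
    finally have "1 / 18 * (1 - \<alpha>) * (ln (real (card Y)) / ln (ln (real (card Y)))) \<le> real (card L)"
      by (simp add: card_L)
    moreover have "finite Y" "N0 \<le> real (card Y)" "finite L"
      using k k_le by (simp_all add: Y_def L_def finite_dyadic_set)
    moreover have "\<forall>l\<in>L. is_line l"
      by (auto simp: L_def is_line_graph_line)
    moreover have "general_position L"
      unfolding L_def by (rule general_position_parabola) simp
    moreover have "\<forall>l\<in>L. rich \<alpha> Y l"
      unfolding L_def Y_def using rich_dyadic [OF \<open>M > 0\<close> _ rich_le] by auto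
    ultimately show ?thesis
      by blast
  qed
qed simp

end
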